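(* For every $n\geq 2$ and every $w\leq n$, there exists a distribution-free interactive proof of proximity for $\mathsf{HAM}(w)$ with perfect completeness and soundness $1/3$ (for inputs $\varepsilon$-far from $\mathsf{HAM}(w)$ with respect to the unknown distribution, every prover strategy makes the verifier accept with probability at most $1/3$). The protocol has round complexity $O\!\left(\frac{2\log(n)}{\varepsilon}\right)$, communication complexity $O\!\left(\frac{\log^{2}(n)}{\varepsilon}\right)$, and sample complexity $\frac{1}{\varepsilon}$. Furthermore, it makes no queries to the input and only uses samples from the distribution.
   Context: For $X\in\{0,1\}^n$, $\mathsf{Hwt}(X)$ is its number of ones, and $\mathsf{HAM}(w)=\{X\in\{0,1\}^n:\mathsf{Hwt}(X)=w\}$. For a distribution $\mathcal{D}$ over $[n]$, $d_{\mathcal{D}}(x,y)=\Pr_{i\sim\mathcal{D}}[x_i\neq y_i]$ and $d_{\mathcal{D}}(x,L)=\min_{y\in L}d_{\mathcal{D}}(x,y)$. A distribution-free interactive proof of proximity with proximity $\varepsilon>0$: a computationally unbounded prover (knowing $X$, $\varepsilon$, $\mathcal{D}$) interacts with a verifier that may query $X$ and call a sample oracle returning $(i,X_i)$ with $i\sim\mathcal{D}$ independently; for every $X$ and every unknown distribution $\mathcal{D}$ over $[n]$, members of the language are accepted by the honest interaction (with probability $1$ under perfect completeness), and inputs with $d_{\mathcal{D}}(X,L)>\varepsilon$ are rejected against every prover with the stated probability.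
   Formalization: The sample complexity is proved as O(1/ε) with a universal constant, not literally 1/ε: with at most 1/ε samples, no queries and perfect completeness, soundness 1/3 fails (w=0, ε=1/6: a cheating prover succeeds with probability about (5/6)^6 > 1/3). *)

theory Defs
  imports "HOL-Probability.Probability"
begin

text \<open>
  Inputs in \<open>{0,1}\<^sup>n\<close> are Boolean lists of length \<open>n\<close>, with \<open>[n]\<close> indexed as \<open>{..<n}\<close>;
  a distribution over \<open>[n]\<close> is a \<open>nat pmf\<close> supported on \<open>{..<n}\<close>.
\<close>

definition Hwt :: "bool list \<Rightarrow> nat" where
  "Hwt X = card {i. i < length X \<and> X ! i}"

definition HAM :: "nat \<Rightarrow> nat \<Rightarrow> bool list set" where
  "HAM n w = {X. length X = n \<and> Hwt X = w}"

definition dist_wrt :: "nat pmf \<Rightarrow> bool list \<Rightarrow> bool list \<Rightarrow> real" where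
  "dist_wrt D x y = measure_pmf.prob D {i. x ! i \<noteq> y ! i}"

text \<open>Only meaningful for nonempty finite \<open>L\<close>; \<open>HAM n w\<close> is such a set whenever \<open>w \<le> n\<close>.\<close>

definition dist_lang :: "nat pmf \<Rightarrow> bool list \<Rightarrow> bool list set \<Rightarrow> real" where
  "dist_lang D x L = Min (dist_wrt D x ` L)"

type_synonym message = "bool list"

text \<open>
  A verifier is a well-founded decision tree whose inner nodes toss a private coin, query a bit of
  the input, call the sample oracle (which returns a pair \<open>(i, X\<^sub>i)\<close>), send a message, or wait for a
  prover message of a prescribed number of bits. The tree itself mentions neither the input nor
  the distribution.
\<close>

datatype verifier =
    Halt bool
  | Toss "bool \<Rightarrow> verifier"
  | Query nat "bool \<Rightarrow> verifier"
  | Sample "nat \<times> bool \<Rightarrow> verifier"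
  | Send message verifier
  | Receive nat "message \<Rightarrow> verifier"

text \<open>
  A (possibly randomized, computationally unbounded) prover strategy maps the messages exchanged so
  far, in both directions, to its next message. It does not see the coins, the queries or the
  samples of the verifier. Knowledge of the input, the proximity parameter and the distribution is
  expressed by letting the strategy depend on them.
\<close>

type_synonym prover = "message list \<Rightarrow> message pmf"

text \<open>
  The distribution of the verifier's decision (\<open>True\<close> is acceptance); the last argument is the
  transcript so far. A prover message of the wrong length leads to rejection.
\<close>

primrec run :: "verifier \<Rightarrow> prover \<Rightarrow> bool list \<Rightarrow> nat pmf \<Rightarrow> message list \<Rightarrow> bool pmf" where
  "run (Halt b) P X D tr = return_pmf b"
| "run (Toss v) P X D tr = bind_pmf (bernoulli_pmf (1/2)) (\<lambda>b. run (v b) P X D tr)"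
| "run (Query i v) P X D tr = run (v (i < length X \<and> X ! i)) P X D tr"
| "run (Sample v) P X D tr = bind_pmf D (\<lambda>i. run (v (i, X ! i)) P X D tr)"
| "run (Send m v) P X D tr = run v P X D (tr @ [m])"
| "run (Receive l v) P X D tr =
     bind_pmf (P tr) (\<lambda>m. if length m = l then run (v m) P X D (tr @ [m]) else return_pmf False)"

definition accept_prob :: "verifier \<Rightarrow> prover \<Rightarrow> bool list \<Rightarrow> nat pmf \<Rightarrow> real" where
  "accept_prob V P X D = pmf (run V P X D []) True"

text \<open>
  Proximity \<open>\<epsilon>\<close>, perfect completeness, and acceptance probability at most \<open>s\<close> on \<open>\<epsilon>\<close>-far inputs.
\<close>

definition distribution_free_IPP ::
  "nat \<Rightarrow> bool list set \<Rightarrow> real \<Rightarrow> real \<Rightarrow> verifier \<Rightarrow> (bool list \<Rightarrow> nat pmf \<Rightarrow> prover) \<Rightarrow> bool" where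
  "distribution_free_IPP n L \<epsilon> s V P \<longleftrightarrow>
     (\<forall>X D. length X = n \<longrightarrow> set_pmf D \<subseteq> {..<n} \<longrightarrow>
        (X \<in> L \<longrightarrow> accept_prob V (P X D) X D = 1) \<and>
        (dist_lang D X L > \<epsilon> \<longrightarrow> (\<forall>P'. accept_prob V P' X D \<le> s)))"

text \<open>
  The directions and lengths of all messages are fixed in advance, so that the verifier cannot
  convey information through the timing or the lengths of messages without being charged for it.
  Every single message, in either direction, counts as a round.
\<close>

datatype sender = From_Verifier | From_Prover

type_synonym schedule = "(sender \<times> nat) list"

primrec follows_schedule :: "verifier \<Rightarrow> schedule \<Rightarrow> bool" where
  "follows_schedule (Halt b) S \<longleftrightarrow> S = []"
| "follows_schedule (Toss v) S \<longleftrightarrow> (\<forall>b. follows_schedule (v b) S)"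
| "follows_schedule (Query i v) S \<longleftrightarrow> (\<forall>b. follows_schedule (v b) S)"
| "follows_schedule (Sample v) S \<longleftrightarrow> (\<forall>p. follows_schedule (v p) S)"
| "follows_schedule (Send m v) S \<longleftrightarrow>
     (\<exists>S'. S = (From_Verifier, length m) # S' \<and> follows_schedule v S')"
| "follows_schedule (Receive l v) S \<longleftrightarrow>
     (\<exists>S'. S = (From_Prover, l) # S' \<and> (\<forall>m. length m = l \<longrightarrow> follows_schedule (v m) S'))"

definition round_complexity :: "schedule \<Rightarrow> nat" where
  "round_complexity S = length S"

definition communication_complexity :: "schedule \<Rightarrow> nat" where
  "communication_complexity S = sum_list (map snd S)"

text \<open>Worst case over all branches, whatever the coins, oracle answers and prover messages are.\<close>

primrec sample_complexity :: "verifier \<Rightarrow> enat" where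
  "sample_complexity (Halt b) = 0"
| "sample_complexity (Toss v) = (SUP b. sample_complexity (v b))"
| "sample_complexity (Query i v) = (SUP b. sample_complexity (v b))"
| "sample_complexity (Sample v) = 1 + (SUP p. sample_complexity (v p))"
| "sample_complexity (Send m v) = sample_complexity v"
| "sample_complexity (Receive l v) = (SUP m. sample_complexity (v m))"

primrec query_complexity :: "verifier \<Rightarrow> enat" where
  "query_complexity (Halt b) = 0"
| "query_complexity (Toss v) = (SUP b. query_complexity (v b))"
| "query_complexity (Query i v) = 1 + (SUP b. query_complexity (v b))"
| "query_complexity (Sample v) = (SUP p. query_complexity (v p))"
| "query_complexity (Send m v) = query_complexity v"
| "query_complexity (Receive l v) = (SUP m. query_complexity (v m))"

text \<open>
  A sample bound of \<open>1/\<epsilon>\<close> has to be read up to a universal constant factor. With a literal bound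
  \<open>q \<le> 1/\<epsilon>\<close>, perfect completeness and no queries, soundness \<open>1/3\<close> is impossible: take \<open>w = 0\<close>,
  \<open>X = 10\<dots>0\<close> and \<open>D\<close> of mass \<open>\<epsilon>' > \<epsilon>\<close> on the position of the one. A prover that plays honestly for
  the all-zero input is accepted whenever no sample hits that position, hence with probability at
  least \<open>(1 - \<epsilon>')\<^sup>q\<close>. For \<open>\<epsilon> = 1/6\<close> and \<open>\<epsilon>'\<close> close to \<open>\<epsilon>\<close> this is about \<open>(5/6)\<^sup>6 > 1/3\<close>, and for
  \<open>\<epsilon> = 1/q\<close> it approaches \<open>1/e > 1/3\<close> as \<open>q\<close> grows.
\<close>

end

theory Submission imports Defs begin

text \<open>
  For each sample \<open>i\<close> the verifier walks down a balanced binary tree of intervals from \<open>[n]\<close> to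
  \<open>{i}\<close>: it announces the current interval, the prover answers with the weight of the left half,
  the weight of the right half being the difference to the weight already claimed for the whole,
  and the verifier continues with the half that contains \<open>i\<close>. It rejects if a claim exceeds the
  length of its interval or if the claim at the leaf differs from the sampled bit. As the prover
  sees only the current interval, the claims of a deterministic prover label all the leaves with a
  word of weight \<open>w\<close> (completed arbitrarily below a node with an inconsistent claim, where every
  sample is rejected), so one sample is accepted with probability at most \<open>1 - \<epsilon>\<close>; for randomized
  provers one averages over the messages at each node. \<open>\<lfloor>3/\<epsilon>\<rfloor>\<close> repetitions give soundness \<open>1/3\<close>.
\<close>

section \<open>The protocol\<close>

definition encode :: "nat \<Rightarrow> nat \<Rightarrow> message" where
  "encode l x = map (bit x) [0..<l]"

definition decode :: "message \<Rightarrow> nat" where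
  "decode bs = horner_sum of_bool 2 bs"

lemma length_encode [simp]: "length (encode l x) = l"
  by (simp add: encode_def)

lemma decode_encode: "x < 2 ^ l \<Longrightarrow> decode (encode l x) = x"
  by (simp add: encode_def decode_def horner_sum_bit_eq_take_bit take_bit_nat_eq_self)

text \<open>
  \<open>descend l d lo m c ok (i, b) K\<close> treats the interval \<open>{lo..<lo + m}\<close> with claimed weight \<open>c\<close>, with
  \<open>d\<close> levels left; \<open>ok\<close> records whether all checks so far succeeded. Failures are only acted upon
  at the very end, since the schedule of messages must not depend on them.
\<close>

primrec descend ::
  "nat \<Rightarrow> nat \<Rightarrow> nat \<Rightarrow> nat \<Rightarrow> nat \<Rightarrow> bool \<Rightarrow> nat \<times> bool \<Rightarrow> (bool \<Rightarrow> verifier) \<Rightarrow> verifier" where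
  "descend l 0 lo m c ok p K = K (ok \<and> c = of_bool (snd p))"
| "descend l (Suc d) lo m c ok p K =
     Send (encode l lo @ encode l m) (Receive l (\<lambda>msg.
       let a = decode msg; h = m div 2; ok' = (ok \<and> a \<le> h \<and> a \<le> c \<and> c - a \<le> m - h)
       in if fst p < lo + h then descend l d lo h a ok' p K
          else descend l d (lo + h) (m - h) (c - a) ok' p K))"

text \<open>Every descent restarts at the root with claim \<open>w\<close>; only the flag
  \<open>ok\<close> survives from one sample to the next.\<close>

primrec repeat_descend :: "nat \<Rightarrow> nat \<Rightarrow> nat \<Rightarrow> nat \<Rightarrow> nat \<Rightarrow> bool \<Rightarrow> verifier" where
  "repeat_descend l d n w 0 ok = Halt ok"
| "repeat_descend l d n w (Suc k) ok =
     Sample (\<lambda>p. descend l d 0 n w ok p (repeat_descend l d n w k))"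

definition interval_weight :: "bool list \<Rightarrow> nat \<Rightarrow> nat \<Rightarrow> nat" where
  "interval_weight X lo m = card {j \<in> {lo..<lo + m}. X ! j}"

text \<open>Stateless: the last verifier message holds the start of the interval in its first
  \<open>l\<close> bits and the length in the rest.\<close>

definition honest_prover :: "nat \<Rightarrow> bool list \<Rightarrow> prover" where
  "honest_prover l X tr =
     return_pmf (encode l (interval_weight X (decode (take l (last tr)))
       (decode (drop l (last tr)) div 2)))"

section \<open>Completeness\<close>

lemma interval_weight_le: "interval_weight X lo m \<le> m"
proof -
  have "interval_weight X lo m \<le> card {lo..<lo + m}"
    unfolding interval_weight_def by (intro card_mono) auto
  then show ?thesis by simp
qed

lemma interval_weight_split:
  assumes "h \<le> m"
  shows "interval_weight X lo m = interval_weight X lo h + interval_weight X (lo + h) (m - h)"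
proof -
  have eq: "{j \<in> {lo..<lo + m}. X ! j} =
      {j \<in> {lo..<lo + h}. X ! j} \<union> {j \<in> {lo + h..<lo + h + (m - h)}. X ! j}"
    using assms by auto
  show ?thesis
    unfolding interval_weight_def eq by (rule card_Un_disjoint) auto
qed

lemma interval_weight_singleton: "interval_weight X lo (Suc 0) = of_bool (X ! lo)"
proof -
  have "{j \<in> {lo..<lo + Suc 0}. X ! j} = (if X ! lo then {lo} else {})" by auto
  then show ?thesis by (simp add: interval_weight_def)
qed

text \<open>Invariant: the claim is the true weight of the current interval, so \<open>c - a\<close>
  is the true weight of the right half and every check passes. \<open>lo + m < 2 ^ l\<close> lets
  all numbers fit into \<open>l\<close> bits; \<open>m \<le> 2 ^ d\<close> leaves only the position
  \<open>i\<close> at depth 0.\<close>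

lemma run_descend_honest:
  assumes K: "\<And>tr. run (K True) (honest_prover l X) X D tr = return_pmf True"
    and "lo + m < 2 ^ l" "m \<le> 2 ^ d" "i \<in> {lo..<lo + m}"
  shows "run (descend l d lo m (interval_weight X lo m) True (i, X ! i) K)
           (honest_prover l X) X D tr = return_pmf True"
  using assms(2-)
proof (induction d arbitrary: lo m tr)
  case 0
  then have "m = Suc 0" "i = lo" by auto
  then show ?case by (simp add: K interval_weight_singleton)
next
  case (Suc d)
  define h where "h = m div 2"
  have h: "h \<le> m" "h \<le> 2 ^ d" "m - h \<le> 2 ^ d" using Suc.prems by (auto simp: h_def)
  define a where "a = interval_weight X lo h"
  have a: "a \<le> h" "a < 2 ^ l" "interval_weight X lo m = a + interval_weight X (lo + h) (m - h)"
    using interval_weight_le[of X lo h] interval_weight_split[OF h(1)] Suc.prems h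
    by (auto simp: a_def)
  have "honest_prover l X (tr @ [encode l lo @ encode l m]) = return_pmf (encode l a)"
    using Suc.prems by (simp add: honest_prover_def decode_encode a_def h_def)
  moreover have "i < lo + h \<Longrightarrow>
      run (descend l d lo h a True (i, X ! i) K) (honest_prover l X) X D tr' = return_pmf True" for tr'
    unfolding a_def by (rule Suc.IH) (use Suc.prems h in auto)
  moreover have "\<not> i < lo + h \<Longrightarrow>
      run (descend l d (lo + h) (m - h) (interval_weight X (lo + h) (m - h)) True (i, X ! i) K)
        (honest_prover l X) X D tr' = return_pmf True" for tr'
    by (rule Suc.IH) (use Suc.prems h in auto)
  ultimately show ?case
    using interval_weight_le[of X "lo + h" "m - h"] a
    by (simp add: bind_return_pmf Let_def decode_encode flip: h_def)
qed

lemma run_repeat_descend_honest: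
  assumes "set_pmf D \<subseteq> {..<n}" "n < 2 ^ l" "n \<le> 2 ^ d"
  shows "run (repeat_descend l d n (interval_weight X 0 n) k True) (honest_prover l X) X D tr
           = return_pmf True"
proof (induction k arbitrary: tr)
  case (Suc k)
  have "run (repeat_descend l d n (interval_weight X 0 n) (Suc k) True) (honest_prover l X) X D tr
      = bind_pmf D (\<lambda>i. return_pmf True)"
    unfolding repeat_descend.simps run.simps
    by (intro bind_pmf_cong refl run_descend_honest) (use assms Suc.IH in auto)
  then show ?case by simp
qed simp

section \<open>Soundness\<close>

text \<open>A failed check is never undone, since \<open>ok\<close> is a conjunct of each later
  flag.\<close>

lemma accept_descend_False:
  assumes "\<And>tr. pmf (run (K False) P X D tr) True = 0"
  shows "pmf (run (descend l d lo m c False p K) P X D tr) True = 0"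
proof (induction d arbitrary: lo m c tr)
  case (Suc d)
  show ?case
    unfolding descend.simps run.simps pmf_bind
    by (rule Bochner_Integration.integral_eq_zero_AE, rule AE_pmfI) (simp add: Let_def Suc.IH)
qed (use assms in simp)

section \<open>Agreement with words of prescribed weight on an interval\<close>

definition agreement :: "nat pmf \<Rightarrow> bool list \<Rightarrow> nat \<Rightarrow> nat \<Rightarrow> nat set \<Rightarrow> real" where
  "agreement D X lo m Y = (\<Sum>i\<in>{lo..<lo + m}. if (i \<in> Y) = X ! i then pmf D i else 0)"

text \<open>Junk value if \<open>m < c\<close>.\<close>

definition max_agreement :: "nat pmf \<Rightarrow> bool list \<Rightarrow> nat \<Rightarrow> nat \<Rightarrow> nat \<Rightarrow> real" where
  "max_agreement D X lo m c =
     Max (agreement D X lo m ` {Y. Y \<subseteq> {lo..<lo + m} \<and> card Y = c})"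

lemma agreement_le_max:
  assumes "Y \<subseteq> {lo..<lo + m}" "card Y = c"
  shows "agreement D X lo m Y \<le> max_agreement D X lo m c"
proof -
  have "finite {Y. Y \<subseteq> {lo..<lo + m} \<and> card Y = c}"
    by (rule finite_subset[of _ "Pow {lo..<lo + m}"]) auto
  then show ?thesis
    unfolding max_agreement_def using assms by (intro Max_ge) auto
qed

lemma max_agreement_attained:
  assumes "c \<le> m"
  obtains Y where "Y \<subseteq> {lo..<lo + m}" "card Y = c" "max_agreement D X lo m c = agreement D X lo m Y"
proof -
  let ?S = "{Y. Y \<subseteq> {lo..<lo + m} \<and> card Y = c}"
  have "finite ?S" by (rule finite_subset[of _ "Pow {lo..<lo + m}"]) auto
  moreover have "?S \<noteq> {}"
    using obtain_subset_with_card_n[of c "{lo..<lo + m}"] assms by auto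
  ultimately have "max_agreement D X lo m c \<in> agreement D X lo m ` ?S"
    unfolding max_agreement_def by (intro Max_in) auto
  then show ?thesis using that by auto
qed

lemma agreement_nonneg: "agreement D X lo m Y \<ge> 0"
  unfolding agreement_def by (intro sum_nonneg) auto

lemma max_agreement_nonneg: "c \<le> m \<Longrightarrow> max_agreement D X lo m c \<ge> 0"
  using max_agreement_attained[of c m lo D X] agreement_nonneg by metis

text \<open>Optimal sets for the two halves are disjoint, and their union is a candidate for the
  whole interval. Consistent claims at a node thus glue two labellings into one of weight
  \<open>c\<close>.\<close>

lemma max_agreement_superadditive:
  assumes "a \<le> h" "a \<le> c" "c - a \<le> m - h" "h \<le> m"
  shows "max_agreement D X lo h a + max_agreement D X (lo + h) (m - h) (c - a)
           \<le> max_agreement D X lo m c"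
proof -
  obtain Y where Y: "Y \<subseteq> {lo..<lo + h}" "card Y = a"
      "max_agreement D X lo h a = agreement D X lo h Y"
    using max_agreement_attained[OF assms(1)] .
  obtain Z where Z: "Z \<subseteq> {lo + h..<lo + h + (m - h)}" "card Z = c - a"
      "max_agreement D X (lo + h) (m - h) (c - a) = agreement D X (lo + h) (m - h) Z"
    using max_agreement_attained[OF assms(3)] .
  have "finite Y" "finite Z" using Y(1) Z(1) finite_subset by blast+
  moreover have "Y \<inter> Z = {}" using Y(1) Z(1) by fastforce
  ultimately have "card (Y \<union> Z) = c"
    using card_Un_disjoint[of Y Z] Y(2) Z(2) assms by simp
  moreover have "Y \<union> Z \<subseteq> {lo..<lo + m}"
    using Y(1) Z(1) assms by fastforce
  ultimately have "agreement D X lo m (Y \<union> Z) \<le> max_agreement D X lo m c"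
    by (intro agreement_le_max)
  moreover have "agreement D X lo m (Y \<union> Z) = agreement D X lo h Y + agreement D X (lo + h) (m - h) Z"
  proof -
    have "agreement D X lo m (Y \<union> Z) =
        (\<Sum>i\<in>{lo..<lo + h}. if (i \<in> Y \<union> Z) = X ! i then pmf D i else 0) +
        (\<Sum>i\<in>{lo + h..<lo + m}. if (i \<in> Y \<union> Z) = X ! i then pmf D i else 0)"
      unfolding agreement_def using assms by (subst sum.atLeastLessThan_concat) auto
    also have "(\<Sum>i\<in>{lo..<lo + h}. if (i \<in> Y \<union> Z) = X ! i then pmf D i else 0) = agreement D X lo h Y"
      unfolding agreement_def using Z(1) by (intro sum.cong) auto
    also have "(\<Sum>i\<in>{lo + h..<lo + m}. if (i \<in> Y \<union> Z) = X ! i then pmf D i else 0)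
        = agreement D X (lo + h) (m - h) Z"
      unfolding agreement_def using Y(1) assms by (intro sum.cong) auto
    finally show ?thesis .
  qed
  ultimately show ?thesis using Y(3) Z(3) by simp
qed

section \<open>Acceptance probability of one descent and of its repetitions\<close>

lemma sum_pmf_bind_le:
  assumes "\<And>x. (\<Sum>i\<in>I. pmf D i * pmf (f i x) y) \<le> B"
  shows "(\<Sum>i\<in>I. pmf D i * pmf (bind_pmf M (f i)) y) \<le> B"
proof -
  have int: "integrable (measure_pmf M) (\<lambda>x. pmf (f i x) y)" for i
    by (rule measure_pmf.integrable_const_bound[where B = 1]) (auto simp: pmf_le_1)
  \<comment> \<open>\<open>M\<close> is the same for all \<open>i\<close>, so the sum moves inside
    the expectation and can be bounded message by message.\<close>
  have "(\<Sum>i\<in>I. pmf D i * pmf (bind_pmf M (f i)) y) =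
      measure_pmf.expectation M (\<lambda>x. \<Sum>i\<in>I. pmf D i * pmf (f i x) y)"
    using int by (simp add: pmf_bind)
  also have "\<dots> \<le> measure_pmf.expectation M (\<lambda>_. B)"
    using int assms by (intro integral_mono) auto
  finally show ?thesis by simp
qed

text \<open>All samples in the interval share the transcript \<open>tr\<close>, so they are bounded
  jointly; \<open>q\<close> bounds the acceptance of the remaining run uniformly in the
  transcript.\<close>

lemma accept_descend_le:
  assumes K: "\<And>tr. pmf (run (K True) P X D tr) True \<le> q"
    "\<And>tr. pmf (run (K False) P X D tr) True = 0"
    and q: "q \<ge> 0" and "c \<le> m" "m \<le> 2 ^ d"
  shows "(\<Sum>i\<in>{lo..<lo + m}. pmf D i * pmf (run (descend l d lo m c True (i, X ! i) K) P X D tr) True)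
           \<le> q * max_agreement D X lo m c"
  using assms(4-)
proof (induction d arbitrary: lo m c tr)
  case 0
  show ?case
  proof (cases "m = 0")
    \<comment> \<open>Halving an interval of length 1 gives an empty left half, so length 0 can
      occur at a leaf.\<close>
    case True
    then show ?thesis using q max_agreement_nonneg[of c m D X lo] 0 by simp
  next
    case False
    then have m: "m = Suc 0" using 0 by simp
    show ?thesis
    proof (cases "c = of_bool (X ! lo)")
      case True
      \<comment> \<open>For a truthful leaf claim, the one-letter word carrying the sampled bit
        agrees with \<open>X\<close> on the full mass of \<open>lo\<close>.\<close>
      define Y where "Y = (if X ! lo then {lo} else {})"
      have "agreement D X lo m Y \<le> max_agreement D X lo m c"
        by (rule agreement_le_max) (auto simp: Y_def m True)
      moreover have "agreement D X lo m Y = pmf D lo"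
        by (simp add: agreement_def m Y_def)
      ultimately have "q * pmf D lo \<le> q * max_agreement D X lo m c"
        using q by (intro mult_left_mono) auto
      moreover have "pmf D lo * pmf (run (K True) P X D tr) True \<le> pmf D lo * q"
        by (intro mult_left_mono K) auto
      ultimately show ?thesis using True m by (simp add: mult.commute)
    next
      case False
      then show ?thesis using K q max_agreement_nonneg[of c m D X lo] 0 m by simp
    qed
  qed
next
  case (Suc d)
  define h where "h = m div 2"
  have h: "h \<le> m" "h \<le> 2 ^ d" "m - h \<le> 2 ^ d" using Suc.prems by (auto simp: h_def)
  \<comment> \<open>\<open>tr'\<close> does not mention \<open>i\<close>: the distribution of the
    answer is common to all samples of the interval, and only the continuation \<open>f i\<close>
    differs.\<close>
  define tr' where "tr' = tr @ [encode l lo @ encode l m]"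
  define f where "f i msg = (if length msg = l
      then run (let a = decode msg; ok' = (a \<le> h \<and> a \<le> c \<and> c - a \<le> m - h)
        in if i < lo + h then descend l d lo h a ok' (i, X ! i) K
           else descend l d (lo + h) (m - h) (c - a) ok' (i, X ! i) K) P X D (tr' @ [msg])
      else return_pmf False)" for i msg
  have run: "run (descend l (Suc d) lo m c True (i, X ! i) K) P X D tr = bind_pmf (P tr') (f i)" for i
    unfolding descend.simps run.simps h_def[symmetric] tr'_def[symmetric]
    by (intro bind_pmf_cong refl) (simp add: f_def Let_def)
  have nonneg: "q * max_agreement D X lo m c \<ge> 0"
    using q max_agreement_nonneg Suc.prems by simp
  have "(\<Sum>i\<in>{lo..<lo + m}. pmf D i * pmf (f i msg) True) \<le> q * max_agreement D X lo m c" for msg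
  proof -
    define a where "a = decode msg"
    consider (bad_length) "length msg \<noteq> l"
      | (bad_claim) "length msg = l" "\<not> (a \<le> h \<and> a \<le> c \<and> c - a \<le> m - h)"
      | (good) "length msg = l" "a \<le> h" "a \<le> c" "c - a \<le> m - h" by blast
    then show ?thesis
    proof cases
      case bad_length
      then show ?thesis using nonneg by (simp add: f_def)
    next
      case bad_claim
      \<comment> \<open>An inconsistent claim turns the flag off for every sample below this
        node.\<close>
      then have "pmf (f i msg) True = 0" for i
        using accept_descend_False[of K P X D, OF K(2)]
        by (auto simp: f_def Let_def simp flip: a_def)
      then show ?thesis using nonneg by simp
    next
      case good
      \<comment> \<open>Splitting at the midpoint separates the samples by the branch that the
        verifier takes, and the induction hypothesis applies to each half.\<close>
      have "(\<Sum>i\<in>{lo..<lo + m}. pmf D i * pmf (f i msg) True) =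
          (\<Sum>i\<in>{lo..<lo + h}. pmf D i * pmf (f i msg) True) +
          (\<Sum>i\<in>{lo + h..<lo + h + (m - h)}. pmf D i * pmf (f i msg) True)"
        using h by (subst sum.atLeastLessThan_concat) auto
      also have "(\<Sum>i\<in>{lo..<lo + h}. pmf D i * pmf (f i msg) True) =
          (\<Sum>i\<in>{lo..<lo + h}. pmf D i *
             pmf (run (descend l d lo h a True (i, X ! i) K) P X D (tr' @ [msg])) True)"
        using good by (intro sum.cong) (auto simp: f_def Let_def simp flip: a_def)
      also have "\<dots> \<le> q * max_agreement D X lo h a"
        using good h by (intro Suc.IH)
      also have "(\<Sum>i\<in>{lo + h..<lo + h + (m - h)}. pmf D i * pmf (f i msg) True) =
          (\<Sum>i\<in>{lo + h..<lo + h + (m - h)}. pmf D i *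
             pmf (run (descend l d (lo + h) (m - h) (c - a) True (i, X ! i) K) P X D (tr' @ [msg])) True)"
        using good by (intro sum.cong) (auto simp: f_def Let_def simp flip: a_def)
      also have "\<dots> \<le> q * max_agreement D X (lo + h) (m - h) (c - a)"
        using good h by (intro Suc.IH)
      also have "q * max_agreement D X lo h a + q * max_agreement D X (lo + h) (m - h) (c - a)
          \<le> q * max_agreement D X lo m c"
        using max_agreement_superadditive[OF good(2-4) h(1), of D X lo] q
        by (simp add: mult_left_mono flip: distrib_left)
      finally show ?thesis by simp
    qed
  qed
  then show ?case unfolding run by (rule sum_pmf_bind_le)
qed

lemma accept_repeat_descend_False:
  "pmf (run (repeat_descend l d n w k False) P X D tr) True = 0"
proof (induction k arbitrary: tr)
  case (Suc k)
  then show ?case by (simp add: pmf_bind accept_descend_False)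
qed simp

text \<open>The bound for the remaining \<open>k\<close> descents plays the role of \<open>q\<close>
  for the first one. It holds for every transcript, so adaptive provers call for no separate
  independence argument.\<close>

lemma accept_repeat_descend_le:
  assumes "set_pmf D \<subseteq> {..<n}" "w \<le> n" "n \<le> 2 ^ d"
  shows "pmf (run (repeat_descend l d n w k True) P X D tr) True \<le> max_agreement D X 0 n w ^ k"
proof (induction k arbitrary: tr)
  case (Suc k)
  let ?A = "\<lambda>i. pmf (run (descend l d 0 n w True (i, X ! i) (repeat_descend l d n w k)) P X D tr) True"
  have "pmf (run (repeat_descend l d n w (Suc k) True) P X D tr) True = measure_pmf.expectation D ?A"
    by (simp add: pmf_bind)
  also have "\<dots> = (\<Sum>i\<in>{0..<0 + n}. pmf D i * ?A i)"
    using assms(1) by (subst integral_measure_pmf[of "{0..<0 + n}"]) auto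
  also have "\<dots> \<le> max_agreement D X 0 n w ^ k * max_agreement D X 0 n w"
    by (intro accept_descend_le Suc.IH accept_repeat_descend_False zero_le_power
        max_agreement_nonneg assms)
  finally show ?case by (simp add: mult.commute)
qed simp

section \<open>From agreement to distance\<close>

lemma Hwt_eq_interval_weight: "Hwt X = interval_weight X 0 (length X)"
  unfolding Hwt_def interval_weight_def by (rule arg_cong[where f = card]) auto

lemma finite_HAM: "finite (HAM n w)"
  by (rule finite_subset[OF _ finite_lists_length_eq[of UNIV n]]) (auto simp: HAM_def)

text \<open>An optimal set \<open>Y\<close> is the set of ones of a word \<open>y\<close> in
  \<open>HAM n w\<close>, and its agreement with \<open>X\<close> is the mass complementary to the
  distance between \<open>X\<close> and \<open>y\<close>.\<close>

lemma max_agreement_le_dist_lang: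
  assumes "set_pmf D \<subseteq> {..<n}" "w \<le> n" "length X = n"
  shows "max_agreement D X 0 n w \<le> 1 - dist_lang D X (HAM n w)"
proof -
  obtain Y where Y: "Y \<subseteq> {0..<0 + n}" "card Y = w"
      "max_agreement D X 0 n w = agreement D X 0 n Y"
    using max_agreement_attained[OF assms(2)] .
  define y where "y = map (\<lambda>i. i \<in> Y) [0..<n]"
  have "{i. i < length y \<and> y ! i} = Y" using Y(1) by (auto simp: y_def)
  then have "y \<in> HAM n w" using Y(2) by (simp add: HAM_def Hwt_def y_def)
  then have "dist_lang D X (HAM n w) \<le> dist_wrt D X y"
    unfolding dist_lang_def by (intro Min_le) (auto simp: finite_HAM)
  moreover have "agreement D X 0 n Y = measure_pmf.prob D {i. i < n \<and> (i \<in> Y) = X ! i}"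
    by (subst measure_measure_pmf_finite)
      (auto simp: agreement_def sum.If_cases intro!: sum.cong)
  \<comment> \<open>Positions from \<open>n\<close> on are out of range for both lists, but they
    form a null set of \<open>D\<close>.\<close>
  moreover have "measure_pmf.prob D {i. i < n \<and> (i \<in> Y) = X ! i} =
      measure_pmf.prob D (UNIV - {i. X ! i \<noteq> y ! i})"
    by (intro measure_pmf.finite_measure_eq_AE AE_pmfI)
      (use assms(1) in \<open>auto simp: y_def subset_iff\<close>)
  moreover have "measure_pmf.prob D (UNIV - {i. X ! i \<noteq> y ! i}) = 1 - dist_wrt D X y"
    using measure_pmf.prob_compl[of "{i. X ! i \<noteq> y ! i}" D] by (simp add: dist_wrt_def)
  ultimately show ?thesis using Y(3) by simp
qed

section \<open>Complexity\<close>

text \<open>The \<open>2 * l\<close> bits name an interval by its start and its length.\<close>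

definition descend_schedule :: "nat \<Rightarrow> nat \<Rightarrow> schedule" where
  "descend_schedule l d = concat (replicate d [(From_Verifier, 2 * l), (From_Prover, l)])"

definition repeat_schedule :: "nat \<Rightarrow> nat \<Rightarrow> nat \<Rightarrow> schedule" where
  "repeat_schedule l d k = concat (replicate k (descend_schedule l d))"

text \<open>Both branches of a node have the same depth left and failures do not end the run early,
  so one schedule fits all samples and claims.\<close>

lemma follows_schedule_descend:
  assumes "\<And>b. follows_schedule (K b) S"
  shows "follows_schedule (descend l d lo m c ok p K) (descend_schedule l d @ S)"
proof (induction d arbitrary: lo m c ok)
  case (Suc d)
  then show ?case by (simp add: descend_schedule_def Let_def)
qed (use assms in \<open>simp add: descend_schedule_def\<close>)

lemma follows_schedule_repeat_descend:
  "follows_schedule (repeat_descend l d n w k ok) (repeat_schedule l d k)"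
  by (induction k arbitrary: ok) (simp_all add: repeat_schedule_def follows_schedule_descend)

lemma round_complexity_repeat_schedule: "round_complexity (repeat_schedule l d k) = k * (2 * d)"
  by (simp add: round_complexity_def repeat_schedule_def descend_schedule_def
      length_concat sum_list_replicate)

lemma communication_complexity_repeat_schedule:
  "communication_complexity (repeat_schedule l d k) = k * (d * (3 * l))"
proof -
  have "sum_list (map snd (descend_schedule l d)) = d * (3 * l)"
    by (induction d) (auto simp: descend_schedule_def)
  then show ?thesis
    by (induction k) (auto simp: communication_complexity_def repeat_schedule_def)
qed

lemma sample_complexity_descend_le:
  assumes "\<And>b. sample_complexity (K b) \<le> s"
  shows "sample_complexity (descend l d lo m c ok p K) \<le> s"
proof (induction d arbitrary: lo m c ok)
  case (Suc d)
  show ?case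
    unfolding descend.simps sample_complexity.simps
    by (rule SUP_least) (simp add: Let_def Suc.IH)
qed (use assms in simp)

lemma sample_complexity_repeat_descend_le:
  "sample_complexity (repeat_descend l d n w k ok) \<le> enat k"
proof (induction k arbitrary: ok)
  case (Suc k)
  have "(SUP p. sample_complexity (descend l d 0 n w ok p (repeat_descend l d n w k))) \<le> enat k"
    by (intro SUP_least sample_complexity_descend_le Suc.IH)
  then have "1 + (SUP p. sample_complexity (descend l d 0 n w ok p (repeat_descend l d n w k)))
      \<le> 1 + enat k"
    by (rule add_left_mono)
  then show ?case by (simp add: one_enat_def)
qed simp

lemma query_complexity_descend:
  assumes "\<And>b. query_complexity (K b) = 0"
  shows "query_complexity (descend l d lo m c ok p K) = 0"
proof (induction d arbitrary: lo m c ok)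
  case (Suc d)
  have "query_complexity (descend l (Suc d) lo m c ok p K) \<le> 0"
    unfolding descend.simps query_complexity.simps
    by (rule SUP_least) (simp add: Let_def Suc.IH)
  then show ?case by simp
qed (use assms in simp)

lemma query_complexity_repeat_descend: "query_complexity (repeat_descend l d n w k ok) = 0"
  by (induction k arbitrary: ok) (simp_all add: query_complexity_descend)

section \<open>Number of repetitions and the final bounds\<close>

lemma power_le_third:
  fixes e :: real
  assumes "0 < e" "e \<le> 1"
  shows "(1 - e) ^ nat \<lfloor>3 / e\<rfloor> \<le> 1 / 3"
proof -
  define k where "k = nat \<lfloor>3 / e\<rfloor>"
  \<comment> \<open>Rounding down loses less than one repetition, so \<open>e \<le> 1\<close> leaves
    an exponent of at least 2, and \<open>exp 2 \<ge> 1 + 2\<close> suffices.\<close>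
  have "3 / e - 1 \<le> real k" using assms by (simp add: k_def)
  then have "3 - e \<le> e * real k" using assms by (simp add: field_simps)
  then have k: "2 \<le> e * real k" using assms by linarith
  have "(1 - e) ^ k \<le> exp (- e) ^ k"
    using assms exp_ge_add_one_self[of "- e"] by (intro power_mono) auto
  also have "\<dots> = exp (- (e * real k))" by (simp add: exp_of_nat_mult[symmetric] mult.commute)
  also have "\<dots> \<le> exp (- 2)" using k by simp
  also have "\<dots> \<le> 1 / 3"
    using exp_ge_add_one_self[of 2] by (simp add: exp_minus field_simps)
  finally show ?thesis by (simp add: k_def)
qed

lemma distribution_free_IPP_repeat_descend:
  assumes "w \<le> n" "n \<le> 2 ^ d" "0 < \<epsilon>"
  shows "distribution_free_IPP n (HAM n w) \<epsilon> (1/3)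
    (repeat_descend (Suc d) d n w (nat \<lfloor>3 / \<epsilon>\<rfloor>) True) (\<lambda>X D. honest_prover (Suc d) X)"
  unfolding distribution_free_IPP_def
proof (intro allI impI conjI)
  fix X :: "bool list" and D :: "nat pmf"
  assume X: "length X = n" and D: "set_pmf D \<subseteq> {..<n}"
  {
    assume "X \<in> HAM n w"
    then have "w = interval_weight X 0 n" using X by (simp add: HAM_def Hwt_eq_interval_weight)
    \<comment> \<open>Since \<open>n\<close> may equal \<open>2 ^ d\<close>, messages use one bit
      more than the depth \<open>d\<close>.\<close>
    moreover have "n < 2 ^ Suc d"
      using assms(2) by (rule le_less_trans) simp
    ultimately show "accept_prob (repeat_descend (Suc d) d n w (nat \<lfloor>3 / \<epsilon>\<rfloor>) True)
        (honest_prover (Suc d) X) X D = 1"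
      using run_repeat_descend_honest[OF D _ assms(2)] by (simp add: accept_prob_def)
  next
    fix P'
    assume "\<epsilon> < dist_lang D X (HAM n w)"
    then have le: "max_agreement D X 0 n w \<le> 1 - \<epsilon>"
      using max_agreement_le_dist_lang[OF D assms(1) X] by simp
    have nonneg: "0 \<le> max_agreement D X 0 n w" by (rule max_agreement_nonneg[OF assms(1)])
    have "accept_prob (repeat_descend (Suc d) d n w (nat \<lfloor>3 / \<epsilon>\<rfloor>) True) P' X D
        \<le> max_agreement D X 0 n w ^ nat \<lfloor>3 / \<epsilon>\<rfloor>"
      unfolding accept_prob_def by (rule accept_repeat_descend_le[OF D assms(1,2)])
    also have "\<dots> \<le> (1 - \<epsilon>) ^ nat \<lfloor>3 / \<epsilon>\<rfloor>" using le nonneg by (rule power_mono)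
    \<comment> \<open>Here \<open>\<epsilon> \<le> 1\<close> because the maximal agreement is
      nonnegative; for larger \<open>\<epsilon>\<close>, where the number of repetitions may be 0,
      no input is far.\<close>
    also have "\<dots> \<le> 1 / 3" using assms(3) le nonneg by (intro power_le_third) auto
    finally show "accept_prob (repeat_descend (Suc d) d n w (nat \<lfloor>3 / \<epsilon>\<rfloor>) True) P' X D \<le> 1 / 3" .
  }
qed

theorem theorem3p20:
  "\<exists>C>0. \<forall>n\<ge>2. \<forall>w\<le>n.
     \<exists>(V :: real \<Rightarrow> verifier) (P :: real \<Rightarrow> bool list \<Rightarrow> nat pmf \<Rightarrow> prover) (S :: real \<Rightarrow> schedule).
       \<forall>\<epsilon>>0.
         distribution_free_IPP n (HAM n w) \<epsilon> (1/3) (V \<epsilon>) (P \<epsilon>) \<and>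
         follows_schedule (V \<epsilon>) (S \<epsilon>) \<and>
         real (round_complexity (S \<epsilon>)) \<le> C * (2 * log 2 (real n) / \<epsilon>) \<and>
         real (communication_complexity (S \<epsilon>)) \<le> C * ((log 2 (real n))\<^sup>2 / \<epsilon>) \<and>
         ereal_of_enat (sample_complexity (V \<epsilon>)) \<le> ereal (C * (1 / \<epsilon>)) \<and>
         query_complexity (V \<epsilon>) = 0"
\<comment> \<open>The constant \<open>54 = 3 * 2 * 9\<close> comes from the communication: for
  \<open>L = log 2 n \<ge> 1\<close> and \<open>d\<close> its ceiling, there are at most
  \<open>3 / \<epsilon>\<close> descents of \<open>d \<le> 2 * L\<close> levels with
  \<open>3 * Suc d \<le> 9 * L\<close> bits each. The round and sample bounds have slack.\<close>
proof (intro exI[of _ "54::real"] conjI allI impI)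
  fix n w :: nat
  assume n: "2 \<le> n" and w: "w \<le> n"
  define L where "L = log 2 (real n)"
  define d where "d = nat \<lceil>L\<rceil>"
  have L: "L \<ge> 1" using n by (simp add: L_def le_log_iff)
  have d: "L \<le> real d" "real d \<le> L + 1" using L by (simp_all add: d_def)
  have "real n = 2 powr L" using n by (simp add: L_def)
  also have "\<dots> \<le> 2 powr real d" using d by simp
  also have "\<dots> = real (2 ^ d)" by (simp add: powr_realpow)
  finally have nd: "n \<le> 2 ^ d" using of_nat_le_iff by blast
  let ?k = "\<lambda>\<epsilon>::real. nat \<lfloor>3 / \<epsilon>\<rfloor>"
  show "\<exists>(V :: real \<Rightarrow> verifier) (P :: real \<Rightarrow> bool list \<Rightarrow> nat pmf \<Rightarrow> prover) (S :: real \<Rightarrow> schedule).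
       \<forall>\<epsilon>>0.
         distribution_free_IPP n (HAM n w) \<epsilon> (1/3) (V \<epsilon>) (P \<epsilon>) \<and>
         follows_schedule (V \<epsilon>) (S \<epsilon>) \<and>
         real (round_complexity (S \<epsilon>)) \<le> 54 * (2 * log 2 (real n) / \<epsilon>) \<and>
         real (communication_complexity (S \<epsilon>)) \<le> 54 * ((log 2 (real n))\<^sup>2 / \<epsilon>) \<and>
         ereal_of_enat (sample_complexity (V \<epsilon>)) \<le> ereal (54 * (1 / \<epsilon>)) \<and>
         query_complexity (V \<epsilon>) = 0"
    unfolding L_def[symmetric]
  proof (intro exI[of _ "\<lambda>\<epsilon>. repeat_descend (Suc d) d n w (?k \<epsilon>) True"]
      exI[of _ "\<lambda>\<epsilon> X D. honest_prover (Suc d) X"]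
      exI[of _ "\<lambda>\<epsilon>. repeat_schedule (Suc d) d (?k \<epsilon>)"] allI impI conjI
      distribution_free_IPP_repeat_descend w nd follows_schedule_repeat_descend
      query_complexity_repeat_descend)
    fix \<epsilon> :: real
    assume \<epsilon>: "0 < \<epsilon>"
    have k: "real (?k \<epsilon>) \<le> 3 / \<epsilon>" using \<epsilon> by simp
    have "real (?k \<epsilon>) * (2 * real d) \<le> 3 / \<epsilon> * (4 * L)"
      by (rule mult_mono[OF k]) (use d L \<epsilon> in auto)
    also have "\<dots> \<le> 54 * (2 * L / \<epsilon>)" using L \<epsilon> by (simp add: field_simps)
    finally show "real (round_complexity (repeat_schedule (Suc d) d (?k \<epsilon>))) \<le> 54 * (2 * L / \<epsilon>)"
      by (simp add: round_complexity_repeat_schedule)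
    have "real (?k \<epsilon>) * (real d * (3 * real (Suc d))) \<le> 3 / \<epsilon> * ((2 * L) * (9 * L))"
    proof (rule mult_mono[OF k])
      show "real d * (3 * real (Suc d)) \<le> (2 * L) * (9 * L)"
        by (rule mult_mono) (use d L in auto)
    qed (use \<epsilon> in auto)
    also have "\<dots> = 54 * (L\<^sup>2 / \<epsilon>)" by (simp add: power2_eq_square)
    finally show "real (communication_complexity (repeat_schedule (Suc d) d (?k \<epsilon>)))
        \<le> 54 * (L\<^sup>2 / \<epsilon>)"
      by (simp only: communication_complexity_repeat_schedule of_nat_mult of_nat_numeral)
    have "ereal_of_enat (sample_complexity (repeat_descend (Suc d) d n w (?k \<epsilon>) True))
        \<le> ereal_of_enat (enat (?k \<epsilon>))"
      by (simp only: ereal_of_enat_le_iff sample_complexity_repeat_descend_le)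
    also have "\<dots> \<le> ereal (3 / \<epsilon>)" using k by simp
    also have "\<dots> \<le> ereal (54 * (1 / \<epsilon>))" using \<epsilon> by (simp add: field_simps)
    finally show "ereal_of_enat (sample_complexity (repeat_descend (Suc d) d n w (?k \<epsilon>) True))
        \<le> ereal (54 * (1 / \<epsilon>))" .
  qed
qed simp

end
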